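(* Let $y$ be an $\mathbb{R}^n$-valued random variable whose probability density function is a Gaussian RBF sum of the form $x\mapsto\sum_{j=1}^J\bar w_j\,\phi(x,\bar\mu_j,\bar\Sigma_j)$, for some integer $J\ge1$, $\bar w_j\in\mathbb{R}$, $\bar\mu_j\in\mathbb{R}^n$ and symmetric positive definite $\bar\Sigma_j\in\mathbb{R}^{n\times n}$. Let $g:\mathbb{R}^n\to\mathbb{R}$ be a Gaussian RBF sum, $g(x)=\sum_{i=1}^M w_i\,\phi(x,\mu_i,\Sigma_i)$, with $M\ge1$, $w_i\in\mathbb{R}$, $\mu_i\in\mathbb{R}^n$ and symmetric positive definite $\Sigma_i\in\mathbb{R}^{n\times n}$. Then the expected value of $g(y)$ is the Gaussian RBF sum $$\mathbb{E}[g(y)]=\sum_{i=1}^M\sum_{j=1}^J w_i\bar w_j\,\phi(\bar\mu_j,\mu_i,\Sigma_i+\bar\Sigma_j).$$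
   Context: For $x,\mu\in\mathbb{R}^n$ and symmetric positive definite $\Sigma\in\mathbb{R}^{n\times n}$, $\phi(x,\mu,\Sigma)=\frac{1}{\sqrt{(2\pi)^n|\Sigma|}}\exp\big[-\tfrac12(x-\mu)^\top\Sigma^{-1}(x-\mu)\big]$, where $|\cdot|$ denotes the determinant. A Gaussian RBF sum is a finite linear combination of such functions with real weights. *)

theory Defs
  imports "HOL-Probability.Probability"
begin

definition sym_pos_def :: "real ^ 'n ^ 'n \<Rightarrow> bool" where
  "sym_pos_def A \<longleftrightarrow> transpose A = A \<and> (\<forall>x. x \<noteq> 0 \<longrightarrow> 0 < x \<bullet> (A *v x))"

definition gaussian_rbf :: "real ^ 'n \<Rightarrow> real ^ 'n \<Rightarrow> real ^ 'n ^ 'n \<Rightarrow> real" where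
  "gaussian_rbf x \<mu> S =
     1 / sqrt ((2 * pi) ^ CARD('n) * det S) *
     exp (- (1 / 2) * ((x - \<mu>) \<bullet> (matrix_inv S *v (x - \<mu>))))"

end

theory Submission
  imports Defs
begin

text \<open>
  Expectation under \<open>y\<close> is integration against its density, so by bilinearity everything
  reduces to one identity, for symmetric positive definite \<open>S\<close> and \<open>T\<close>:
  \<open>\<integral> \<phi>(x, \<mu>, S) \<phi>(x, \<nu>, T) dx = \<phi>(\<nu>, \<mu>, S + T)\<close>. (Probabilistically: the sum of independent
  centred Gaussians with covariances \<open>S\<close> and \<open>T\<close> is Gaussian with covariance \<open>S + T\<close>.)
  The weights of the density may be negative, but each Gaussian product is integrable on its own,
  so exchanging sums and integral is harmless.

  The identity (lemma \<open>has_bochner_integral_gaussian_rbf_mult\<close>) has two ingredients.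
  Completing the square in the sum of the two exponents leaves a quadratic form with matrix
  \<open>S\<inverse> + T\<inverse>\<close> in a shifted variable plus the constant \<open>(\<nu> - \<mu>) \<bullet> (S + T)\<inverse> (\<nu> - \<mu>)\<close>
  (\<open>sum_quadratic_forms_complete_square\<close>), and \<open>S (S\<inverse> + T\<inverse>) T = S + T\<close> makes the determinants
  match (\<open>det_sum_matrix_inv\<close>). What remains is the Gaussian integral
  \<open>\<integral> exp (- x \<bullet> Q x / 2) dx = \<surd>((2 \<pi>)\<^sup>n / det Q)\<close>.

  The Gaussian integral is computed by symmetric Gaussian elimination: a shear adding to one
  coordinate a linear combination of the others preserves Lebesgue measure, by Fubini and translation invariance on the line, and has determinant \<open>1\<close>,
  so both sides stay unchanged while the off-diagonal entries of \<open>Q\<close> are cleared one index at a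
  time (\<open>gaussian_integral_elimination\<close>). For diagonal \<open>Q\<close> the integral is a product of
  one-dimensional ones.
\<close>

section \<open>Translations and shears preserve Lebesgue measure\<close>

lemma nn_integral_lborel_translation:
  fixes c :: "'a::euclidean_space"
  assumes [measurable]: "f \<in> borel_measurable borel"
  shows "(\<integral>\<^sup>+x. f (c + x) \<partial>lborel) = (\<integral>\<^sup>+x. f x \<partial>lborel)"
proof -
  have "(\<integral>\<^sup>+x. f x \<partial>lborel) = (\<integral>\<^sup>+x. f x \<partial>distr lborel borel ((+) c))"
    by (simp add: lborel_distr_plus)
  also have "\<dots> = (\<integral>\<^sup>+x. f (c + x) \<partial>lborel)"
    by (simp add: nn_integral_distr)
  finally show ?thesis by simp
qed

text \<open>
  Fubini splits off the coordinate along \<open>e\<close>. As \<open>a\<close> is orthogonal to \<open>e\<close>, the amount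
  \<open>a \<bullet> x\<close> is constant on every line parallel to \<open>e\<close>, so the shear merely translates each such line.
\<close>

lemma nn_integral_lborel_shear:
  fixes e a :: "'a::euclidean_space"
  assumes e: "e \<in> Basis" and orth: "a \<bullet> e = 0"
    and f[measurable]: "f \<in> borel_measurable borel"
  shows "(\<integral>\<^sup>+x. f (x + (a \<bullet> x) *\<^sub>R e) \<partial>lborel) = (\<integral>\<^sup>+x. f x \<partial>lborel)"
proof -
  interpret product_sigma_finite "\<lambda>_::'a. lborel :: real measure"
    by standard
  let ?v = "\<lambda>u. \<Sum>b\<in>Basis - {e}. u b *\<^sub>R b"
  have Basis_split: "insert e (Basis - {e}) = Basis"
    using e by auto
  have sum_split: "(\<Sum>b\<in>Basis. (u(e := t)) b *\<^sub>R b) = ?v u + t *\<^sub>R e" for u :: "'a \<Rightarrow> real" and t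
  proof -
    have "(\<Sum>b\<in>Basis. (u(e := t)) b *\<^sub>R b) = t *\<^sub>R e + (\<Sum>b\<in>Basis - {e}. (u(e := t)) b *\<^sub>R b)"
      by (subst sum.remove[OF _ e]) auto
    also have "(\<Sum>b\<in>Basis - {e}. (u(e := t)) b *\<^sub>R b) = ?v u"
      by (rule sum.cong) auto
    finally show ?thesis by (simp add: add.commute)
  qed
  have fubini: "(\<integral>\<^sup>+x. h x \<partial>lborel) =
      (\<integral>\<^sup>+u. \<integral>\<^sup>+t. h (?v u + t *\<^sub>R e) \<partial>lborel \<partial>Pi\<^sub>M (Basis - {e}) (\<lambda>_. lborel))"
    if [measurable]: "h \<in> borel_measurable borel" for h :: "'a \<Rightarrow> ennreal"
  proof -
    have "(\<integral>\<^sup>+x. h x \<partial>lborel) = (\<integral>\<^sup>+u. h (\<Sum>b\<in>Basis. u b *\<^sub>R b) \<partial>Pi\<^sub>M Basis (\<lambda>_. lborel))"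
      by (subst lborel_eq) (simp add: nn_integral_distr)
    also have "\<dots> = (\<integral>\<^sup>+u. h (\<Sum>b\<in>Basis. u b *\<^sub>R b) \<partial>Pi\<^sub>M (insert e (Basis - {e})) (\<lambda>_. lborel))"
      by (simp only: Basis_split)
    also have "\<dots> = (\<integral>\<^sup>+u. \<integral>\<^sup>+t. h (\<Sum>b\<in>Basis. (u(e := t)) b *\<^sub>R b) \<partial>lborel \<partial>Pi\<^sub>M (Basis - {e}) (\<lambda>_. lborel))"
      by (rule product_nn_integral_insert) (auto simp: Basis_split)
    finally show ?thesis by (simp only: sum_split)
  qed
  have line: "(\<integral>\<^sup>+t. f (?v u + t *\<^sub>R e + (a \<bullet> (?v u + t *\<^sub>R e)) *\<^sub>R e) \<partial>lborel) =
      (\<integral>\<^sup>+t. f (?v u + t *\<^sub>R e) \<partial>lborel)" for u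
  proof -
    have shift: "?v u + t *\<^sub>R e + (a \<bullet> (?v u + t *\<^sub>R e)) *\<^sub>R e = ?v u + ((a \<bullet> ?v u) + t) *\<^sub>R e" for t
      using orth by (simp add: inner_add_right algebra_simps)
    show ?thesis
      unfolding shift
      by (rule nn_integral_lborel_translation[where f = "\<lambda>t. f (?v u + t *\<^sub>R e)"]) measurable
  qed
  show ?thesis
    by (subst (1 2) fubini) (auto simp: line)
qed

section \<open>Symmetric positive definite matrices\<close>

lemma inner_matrix_axis: "axis i 1 \<bullet> (A *v axis j 1) = (A $ i $ j :: real)"
  by (simp add: matrix_vector_mult_basis inner_axis' column_def)

lemma inner_transpose_matrix: "x \<bullet> (transpose A *v y) = (A *v x) \<bullet> (y :: real^'n)" for A :: "real^'m^'n"
  by (metis dot_lmul_matrix inner_commute transpose_matrix_vector)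

lemma sym_pos_def_inner_commute:
  "sym_pos_def A \<Longrightarrow> x \<bullet> (A *v y) = (A *v x) \<bullet> y"
  unfolding sym_pos_def_def by (metis inner_transpose_matrix)

lemma sym_pos_def_add: "sym_pos_def A \<Longrightarrow> sym_pos_def B \<Longrightarrow> sym_pos_def (A + B)"
  unfolding sym_pos_def_def
  by (auto simp: transpose_def vec_eq_iff matrix_vector_mult_add_rdistrib inner_add_right intro!: add_pos_pos)

lemma sym_pos_def_congruence:
  assumes Q: "sym_pos_def Q" and E: "invertible E"
  shows "sym_pos_def (transpose E ** Q ** E)"
proof -
  have "E *v x \<noteq> 0" if "x \<noteq> 0" for x
    using inj_matrix_vector_mult[OF E] that by (metis injD matrix_vector_mult_0_right)
  moreover have "transpose Q = Q"
    using Q by (simp add: sym_pos_def_def)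
  moreover have "x \<bullet> ((transpose E ** Q ** E) *v x) = (E *v x) \<bullet> (Q *v (E *v x))" for x
    by (simp only: matrix_vector_mul_assoc[symmetric] inner_transpose_matrix)
  ultimately show ?thesis
    using Q unfolding sym_pos_def_def
    by (metis matrix_mul_assoc matrix_transpose_mul transpose_transpose)
qed

lemma sym_pos_def_diag_pos: "sym_pos_def Q \<Longrightarrow> 0 < Q $ i $ i"
  unfolding sym_pos_def_def by (metis inner_matrix_axis axis_eq_0_iff zero_neq_one)

lemma sym_pos_def_invertible:
  assumes "sym_pos_def A" shows "invertible A"
proof -
  have "inj ((*v) A)"
  proof (rule injI)
    fix x y assume "A *v x = A *v y"
    then have "(x - y) \<bullet> (A *v (x - y)) = 0"
      by (simp add: matrix_vector_mult_diff_distrib)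
    then show "x = y"
      using assms unfolding sym_pos_def_def by (metis eq_iff_diff_eq_0 less_irrefl)
  qed
  then show ?thesis
    by (meson invertible_left_inverse matrix_left_invertible_injective)
qed

lemma matrix_inv_mult:
  assumes "invertible A"
  shows "A ** matrix_inv A = mat 1" "matrix_inv A ** A = mat 1"
proof -
  have "\<exists>B. A ** B = mat 1 \<and> B ** A = mat 1"
    using assms by (simp add: invertible_def)
  from someI_ex[OF this] show "A ** matrix_inv A = mat 1" "matrix_inv A ** A = mat 1"
    by (simp_all add: matrix_inv_def)
qed

text \<open>
  The inverse \<open>B\<close> of \<open>A\<close> turns the congruence \<open>B\<^sup>T A B\<close> into \<open>B\<^sup>T\<close>. Hence \<open>B\<^sup>T\<close> is symmetric
  positive definite; being symmetric, it equals \<open>B\<close>.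
\<close>

lemma sym_pos_def_matrix_inv:
  assumes A: "sym_pos_def A" shows "sym_pos_def (matrix_inv A)"
proof -
  let ?B = "matrix_inv A"
  note inv = matrix_inv_mult[OF sym_pos_def_invertible[OF A]]
  have "invertible ?B"
    using inv by (auto simp: invertible_def)
  from sym_pos_def_congruence[OF A this]
  have *: "sym_pos_def (transpose ?B)"
    by (simp add: matrix_mul_assoc[symmetric] inv)
  then have "transpose ?B = ?B" by (simp add: sym_pos_def_def)
  with * show ?thesis by simp
qed

text \<open>
  This matrix arises from the identity by adding to row \<open>k\<close> a combination of the other rows.
\<close>

lemma det_shear:
  fixes a :: "real^'n"
  assumes "a $ k = 0"
  shows "det ((\<chi> i. if i = k then axis k 1 + a else axis i 1) :: real^'n^'n) = 1"
proof -
  have row: "row i (mat 1 :: real^'n^'n) = axis i 1" for i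
    by (simp add: row_def mat_def axis_def vec_eq_iff)
  have "a = (\<Sum>i\<in>UNIV. a $ i *s axis i 1)"
    by (simp add: basis_expansion)
  also have "\<dots> = (\<Sum>i\<in>UNIV - {k}. a $ i *s axis i 1)"
    using assms by (intro sum.mono_neutral_right) auto
  also have "\<dots> \<in> vec.span {row j (mat 1 :: real^'n^'n) |j. j \<noteq> k}"
    by (intro vec.span_sum vec.span_scale vec.span_base) (auto simp: row)
  finally show ?thesis
    using det_row_span[of a "mat 1 :: real^'n^'n" k] unfolding row by simp
qed

section \<open>The multivariate Gaussian integral\<close>

lemma nn_integral_gaussian_real:
  assumes "0 < q"
  shows "(\<integral>\<^sup>+t. ennreal (exp (- (1/2) * (q * t\<^sup>2))) \<partial>lborel) = ennreal (sqrt (2 * pi / q))"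
proof -
  let ?\<sigma> = "1 / sqrt q"
  have "(\<integral>\<^sup>+t. ennreal (exp (- (1/2) * (q * t\<^sup>2))) \<partial>lborel) =
      (\<integral>\<^sup>+t. ennreal (sqrt (2 * pi / q)) * ennreal (normal_density 0 ?\<sigma> t) \<partial>lborel)"
    using assms
    by (intro nn_integral_cong)
       (simp add: normal_density_def ennreal_mult'[symmetric] power_divide real_sqrt_divide
         real_sqrt_mult field_simps)
  also have "\<dots> = ennreal (sqrt (2 * pi / q)) * (\<integral>\<^sup>+t. ennreal (normal_density 0 ?\<sigma> t) \<partial>lborel)"
    by (simp add: nn_integral_cmult)
  also have "(\<integral>\<^sup>+t. ennreal (normal_density 0 ?\<sigma> t) \<partial>lborel) = 1"
    using assms by (subst nn_integral_eq_integral) auto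
  finally show ?thesis by simp
qed

lemma borel_measurable_matrix_vector_mult[measurable]:
  "(\<lambda>x. (A :: real^'n^'m) *v x) \<in> borel_measurable borel"
  by (intro borel_measurable_continuous_onI linear_continuous_on matrix_vector_mul_bounded_linear)

lemma real_sqrt_prod: "sqrt (\<Prod>i\<in>A. f i) = (\<Prod>i\<in>A. sqrt (f i))"
  by (induction A rule: infinite_finite_induct) (simp_all add: real_sqrt_mult)

text \<open>
  The integrand is a product of functions of single coordinates. Positivity of the determinant is
  carried along with the integral because elimination transports both facts at once.
\<close>

lemma gaussian_integral_diagonal:
  fixes Q :: "real^'n^'n"
  assumes Q: "sym_pos_def Q" and diag: "\<And>i j. j \<noteq> i \<Longrightarrow> Q $ i $ j = 0"
  shows "0 < det Q \<and> (\<integral>\<^sup>+x. ennreal (exp (- (1/2) * (x \<bullet> (Q *v x)))) \<partial>lborel) =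
    ennreal (sqrt ((2 * pi) ^ CARD('n) / det Q))"
proof -
  have pos: "0 < Q $ i $ i" for i
    using Q by (rule sym_pos_def_diag_pos)
  have det: "det Q = (\<Prod>i\<in>UNIV. Q $ i $ i)"
    using diag by (intro det_diagonal) auto
  have Basis: "(\<Prod>b\<in>Basis. h b) = (\<Prod>i\<in>UNIV. h (axis i 1))" for h :: "real^'n \<Rightarrow> 'b::comm_monoid_mult"
  proof -
    have "Basis = range (\<lambda>i::'n. axis i (1::real))"
      by (auto simp: Basis_vec_def)
    then have "(\<Prod>b\<in>Basis. h b) = (\<Prod>b\<in>range (\<lambda>i::'n. axis i (1::real)). h b)"
      by (rule arg_cong)
    also have "\<dots> = (\<Prod>i\<in>UNIV. h (axis i 1))"
      by (subst prod.reindex) (auto simp: inj_on_def axis_eq_axis)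
    finally show ?thesis .
  qed
  have quad: "x \<bullet> (Q *v x) = (\<Sum>i\<in>UNIV. Q $ i $ i * (x $ i)\<^sup>2)" for x
  proof -
    have "(Q *v x) $ i = Q $ i $ i * x $ i" for i
      using diag by (simp add: matrix_vector_mult_def sum.remove[of UNIV i])
    then show ?thesis
      by (simp add: inner_vec_def power2_eq_square mult_ac)
  qed
  (* Writing the entry of Q at i as the value of its form at the basis vector b turns the factors
     into functions indexed by Basis, as Fubini over Basis requires. *)
  have "(\<integral>\<^sup>+x. ennreal (exp (- (1/2) * (x \<bullet> (Q *v x)))) \<partial>lborel) =
      (\<integral>\<^sup>+x. (\<Prod>b\<in>Basis. ennreal (exp (- (1/2) * ((b \<bullet> (Q *v b)) * (x \<bullet> b)\<^sup>2)))) \<partial>lborel)"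
    unfolding Basis inner_matrix_axis unfolding quad
    by (simp add: inner_axis prod_ennreal exp_sum[symmetric] sum_distrib_left sum_negf)
  also have "\<dots> = (\<Prod>b\<in>Basis. \<integral>\<^sup>+t. ennreal (exp (- (1/2) * ((b \<bullet> (Q *v b)) * t\<^sup>2))) \<partial>lborel)"
    by (rule nn_integral_lborel_prod) auto
  also have "\<dots> = (\<Prod>i\<in>(UNIV::'n set). ennreal (sqrt (2 * pi / Q $ i $ i)))"
    unfolding Basis by (simp only: inner_matrix_axis nn_integral_gaussian_real[OF pos])
  also have "\<dots> = ennreal (\<Prod>i\<in>(UNIV::'n set). sqrt (2 * pi / Q $ i $ i))"
    using pos by (intro prod_ennreal) (simp add: less_imp_le)
  also have "(\<Prod>i\<in>(UNIV::'n set). sqrt (2 * pi / Q $ i $ i)) = sqrt ((2 * pi) ^ CARD('n) / det Q)"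
    by (simp add: det prod_dividef flip: real_sqrt_prod)
  finally show ?thesis
    using pos by (simp add: det prod_pos)
qed


text \<open>
  \<open>K\<close> contains the indices whose rows may still have off-diagonal entries. To remove \<open>k\<close> from \<open>K\<close>,
  substitute \<open>x \<mapsto> E x\<close> with the shear \<open>E\<close> that completes the square in the \<open>k\<close>-th coordinate; this
  replaces \<open>Q\<close> by the congruent matrix \<open>Q' = E\<^sup>T Q E\<close>, which has the same determinant. Rows already
  cleared stay clear, since such an index does not interact with \<open>k\<close>.
\<close>

lemma gaussian_integral_elimination:
  fixes Q :: "real^'n^'n"
  assumes "finite K" "sym_pos_def Q" "\<And>i j. i \<notin> K \<Longrightarrow> j \<noteq> i \<Longrightarrow> Q $ i $ j = 0"
  shows "0 < det Q \<and> (\<integral>\<^sup>+x. ennreal (exp (- (1/2) * (x \<bullet> (Q *v x)))) \<partial>lborel) =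
    ennreal (sqrt ((2 * pi) ^ CARD('n) / det Q))"
  using assms
proof (induction K arbitrary: Q rule: finite_induct)
  case empty
  then show ?case by (intro gaussian_integral_diagonal) auto
next
  case (insert k K)
  note Q = \<open>sym_pos_def Q\<close>
  have Qkk: "0 < Q $ k $ k"
    using Q by (rule sym_pos_def_diag_pos)
  have sym: "Q $ i $ j = Q $ j $ i" for i j
    using Q unfolding sym_pos_def_def transpose_def by (metis vec_lambda_beta)
  (* x k + (sum over j \<noteq> k of Q k j * x j) / Q k k is the square completed in x k, so shearing by the
     negative of this combination removes all products x k * x j from the form. *)
  define a where "a = (\<chi> j. if j = k then 0 else - (Q $ k $ j / Q $ k $ k))"
  define E :: "real^'n^'n" where "E = (\<chi> i. if i = k then axis k 1 + a else axis i 1)"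
  define Q' where "Q' = transpose E ** Q ** E"
  have a_k: "a $ k = 0" by (simp add: a_def)
  have E: "E *v x = x + (a \<bullet> x) *\<^sub>R axis k 1" for x
    by (simp add: vec_eq_iff E_def matrix_vector_mul_component inner_add_left inner_axis') (simp add: axis_def)
  have det_E: "det E = 1"
    unfolding E_def using a_k by (rule det_shear)
  then have "invertible E" by (simp add: invertible_det_nz)
  with Q have Q': "sym_pos_def Q'"
    unfolding Q'_def by (rule sym_pos_def_congruence)
  have det_Q': "det Q' = det Q"
    by (simp add: Q'_def det_mul det_E)
  have form: "x \<bullet> (Q' *v y) = (E *v x) \<bullet> (Q *v (E *v y))" for x y
    by (simp only: Q'_def matrix_vector_mul_assoc[symmetric] inner_transpose_matrix)
  (* Column j of E is axis j + a j * axis k, so the entries follow by bilinearity. *)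
  have entry: "Q' $ i $ j = Q $ i $ j + a $ j * Q $ i $ k + a $ i * Q $ k $ j + a $ i * a $ j * Q $ k $ k" for i j
  proof -
    have "Q' $ i $ j = (axis i 1 + a $ i *\<^sub>R axis k 1) \<bullet> (Q *v (axis j 1 + a $ j *\<^sub>R axis k 1))"
      by (simp only: inner_matrix_axis[symmetric] form E) (simp add: inner_axis)
    then show ?thesis
      by (simp add: matrix_vector_right_distrib matrix_vector_mult_scaleR inner_add_left
          inner_add_right inner_matrix_axis algebra_simps)
  qed
  have "Q' $ i $ j = 0" if "i \<notin> K" "j \<noteq> i" for i j
  proof (cases "i = k")
    case True
    then show ?thesis
      using \<open>j \<noteq> i\<close> Qkk by (simp add: entry a_k) (simp add: a_def)
  next
    case False
    then have isolated: "Q $ i $ l = 0" if "l \<noteq> i" for l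
      using insert.prems(2) \<open>i \<notin> K\<close> that by blast
    then have "a $ i = 0"
      using False by (simp add: a_def sym[of k i])
    then show ?thesis
      using isolated False \<open>j \<noteq> i\<close> by (simp add: entry)
  qed
  from insert.IH[OF Q' this]
  have IH: "0 < det Q" "(\<integral>\<^sup>+x. ennreal (exp (- (1/2) * (x \<bullet> (Q' *v x)))) \<partial>lborel) =
      ennreal (sqrt ((2 * pi) ^ CARD('n) / det Q))"
    by (auto simp: det_Q')
  have "(\<integral>\<^sup>+x. ennreal (exp (- (1/2) * (x \<bullet> (Q' *v x)))) \<partial>lborel) =
      (\<integral>\<^sup>+x. ennreal (exp (- (1/2) * (x \<bullet> (Q *v x)))) \<partial>lborel)"
    unfolding form E
    by (rule nn_integral_lborel_shear) (auto simp: inner_axis a_k)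
  with IH show ?case by simp
qed

lemma sym_pos_def_det_pos: "sym_pos_def Q \<Longrightarrow> 0 < det Q"
  using gaussian_integral_elimination[of UNIV Q] by simp

lemma gaussian_integral:
  fixes Q :: "real^'n^'n"
  assumes "sym_pos_def Q"
  shows "(\<integral>\<^sup>+x. ennreal (exp (- (1/2) * ((x - c) \<bullet> (Q *v (x - c))))) \<partial>lborel) =
    ennreal (sqrt ((2 * pi) ^ CARD('n) / det Q))"
  using gaussian_integral_elimination[of UNIV Q] assms
    nn_integral_lborel_translation[of "\<lambda>x. ennreal (exp (- (1/2) * (x \<bullet> (Q *v x))))" "- c"]
  by simp

section \<open>The integral of a product of two Gaussians\<close>

text \<open>
  Put \<open>q = (S + T)\<inverse> (\<nu> - \<mu>)\<close>, so that \<open>\<nu> - \<mu> = S q + T q\<close>, and \<open>t = x - (\<nu> - T q)\<close>. Then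
  \<open>x - \<mu> = t + S q\<close> and \<open>x - \<nu> = t - T q\<close>. The forms of \<open>S\<inverse>\<close> and \<open>T\<inverse>\<close> at these vectors have the
  cross terms \<open>2 q \<bullet> t\<close> and \<open>- 2 q \<bullet> t\<close>, which cancel, and the constant terms \<open>q \<bullet> S q\<close> and
  \<open>q \<bullet> T q\<close>, which add up to \<open>q \<bullet> (\<nu> - \<mu>)\<close>.
\<close>

lemma sum_quadratic_forms_complete_square:
  fixes S T :: "real^'n^'n" and \<mu> \<nu> :: "real^'n"
  assumes S: "sym_pos_def S" and T: "sym_pos_def T"
  defines "q \<equiv> matrix_inv (S + T) *v (\<nu> - \<mu>)"
  shows "(x - \<mu>) \<bullet> (matrix_inv S *v (x - \<mu>)) + (x - \<nu>) \<bullet> (matrix_inv T *v (x - \<nu>)) =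
    (x - (\<nu> - T *v q)) \<bullet> ((matrix_inv S + matrix_inv T) *v (x - (\<nu> - T *v q))) +
    (\<nu> - \<mu>) \<bullet> q"
proof -
  let ?A = "matrix_inv S" and ?B = "matrix_inv T"
  define t where "t = x - (\<nu> - T *v q)"
  have inv: "?A *v (S *v v) = v" "?B *v (T *v v) = v" for v
    using matrix_inv_mult(2)[OF sym_pos_def_invertible[OF S]]
      matrix_inv_mult(2)[OF sym_pos_def_invertible[OF T]]
    by (simp_all add: matrix_vector_mul_assoc)
  have "(S + T) *v q = \<nu> - \<mu>"
    using matrix_inv_mult(1)[OF sym_pos_def_invertible[OF sym_pos_def_add[OF S T]]]
    by (simp add: q_def matrix_vector_mul_assoc)
  then have d: "\<nu> - \<mu> = S *v q + T *v q"
    by (simp add: matrix_vector_mult_add_rdistrib)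
  have x_\<nu>: "x - \<nu> = t - T *v q" and x_\<mu>: "x - \<mu> = t + S *v q"
    using d by (auto simp: t_def algebra_simps)
  have A: "(S *v q) \<bullet> (?A *v t) = q \<bullet> t" and B: "(T *v q) \<bullet> (?B *v t) = q \<bullet> t"
    using sym_pos_def_inner_commute[OF sym_pos_def_matrix_inv[OF S]]
      sym_pos_def_inner_commute[OF sym_pos_def_matrix_inv[OF T]] by (simp_all add: inv)
  show ?thesis
    unfolding x_\<nu> x_\<mu> t_def[symmetric] d
    by (simp add: matrix_vector_right_distrib matrix_vector_mult_diff_distrib
        matrix_vector_mult_add_rdistrib inner_add_left inner_add_right inner_diff_left
        inner_diff_right inv A B inner_commute)
qed

lemma det_sum_matrix_inv:
  fixes S T :: "real^'n^'n"
  assumes S: "sym_pos_def S" and T: "sym_pos_def T"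
  shows "det (matrix_inv S + matrix_inv T) = det (S + T) / (det S * det T)"
proof -
  let ?A = "matrix_inv S" and ?B = "matrix_inv T"
  have inv: "S *v (?A *v v) = v" "?B *v (T *v v) = v" for v
    using matrix_inv_mult[OF sym_pos_def_invertible[OF S]]
      matrix_inv_mult[OF sym_pos_def_invertible[OF T]]
    by (simp_all add: matrix_vector_mul_assoc)
  have "S ** (?A + ?B) ** T = T + S"
    by (simp add: matrix_eq matrix_vector_mul_assoc[symmetric] matrix_vector_mult_add_rdistrib
        matrix_vector_right_distrib inv)
  then have "det S * det (?A + ?B) * det T = det (S + T)"
    by (metis add.commute det_mul)
  then show ?thesis
    using sym_pos_def_det_pos[OF S] sym_pos_def_det_pos[OF T] by (simp add: field_simps)
qed

lemma gaussian_rbf_nonneg: "sym_pos_def S \<Longrightarrow> 0 \<le> gaussian_rbf x \<mu> S"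
  using sym_pos_def_det_pos[of S] by (simp add: gaussian_rbf_def)

lemma borel_measurable_gaussian_rbf[measurable]:
  "(\<lambda>x. gaussian_rbf x \<mu> S) \<in> borel_measurable borel"
  unfolding gaussian_rbf_def by measurable

text \<open>
  By completing the square the product is a constant \<open>Z\<close> times a Gaussian with precision matrix
  \<open>S\<inverse> + T\<inverse>\<close>. \<open>Z\<close> already contains the exponential of the right-hand side, and the Gaussian integral
  together with the determinant identity supplies its normalisation.
\<close>

lemma has_bochner_integral_gaussian_rbf_mult:
  fixes S T :: "real^'n^'n"
  assumes S: "sym_pos_def S" and T: "sym_pos_def T"
  shows "has_bochner_integral lborel (\<lambda>x. gaussian_rbf x \<mu> S * gaussian_rbf x \<nu> T)
    (gaussian_rbf \<nu> \<mu> (S + T))"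
proof -
  let ?N = "matrix_inv S + matrix_inv T"
  let ?q = "matrix_inv (S + T) *v (\<nu> - \<mu>)"
  let ?c = "\<nu> - T *v ?q"
  define Z where "Z = 1 / sqrt ((2 * pi) ^ CARD('n) * det S) * (1 / sqrt ((2 * pi) ^ CARD('n) * det T)) *
    exp (- (1/2) * ((\<nu> - \<mu>) \<bullet> ?q))"
  note pos = sym_pos_def_det_pos[OF S] sym_pos_def_det_pos[OF T] sym_pos_def_det_pos[OF sym_pos_def_add[OF S T]]
  have Z: "0 \<le> Z"
    using pos by (simp add: Z_def)
  have N: "sym_pos_def ?N"
    using S T by (intro sym_pos_def_add sym_pos_def_matrix_inv)
  have mult: "gaussian_rbf x \<mu> S * gaussian_rbf x \<nu> T = Z * exp (- (1/2) * ((x - ?c) \<bullet> (?N *v (x - ?c))))" for x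
  proof -
    have "exp (- (1/2) * ((x - \<mu>) \<bullet> (matrix_inv S *v (x - \<mu>)))) *
        exp (- (1/2) * ((x - \<nu>) \<bullet> (matrix_inv T *v (x - \<nu>)))) =
        exp (- (1/2) * ((x - \<mu>) \<bullet> (matrix_inv S *v (x - \<mu>)) + (x - \<nu>) \<bullet> (matrix_inv T *v (x - \<nu>))))"
      by (simp only: exp_add[symmetric] distrib_left)
    also have "\<dots> = exp (- (1/2) * ((\<nu> - \<mu>) \<bullet> ?q)) * exp (- (1/2) * ((x - ?c) \<bullet> (?N *v (x - ?c))))"
      by (simp only: sum_quadratic_forms_complete_square[OF S T] exp_add[symmetric] distrib_left add.commute)
    finally show ?thesis
      unfolding gaussian_rbf_def Z_def by (simp only: mult_ac)
  qed
  have const: "Z * sqrt ((2 * pi) ^ CARD('n) / det ?N) = gaussian_rbf \<nu> \<mu> (S + T)"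
  proof -
    define p where "p = (2 * pi) ^ CARD('n)"
    have p: "0 < p" by (simp add: p_def)
    let ?e = "exp (- (1/2) * ((\<nu> - \<mu>) \<bullet> ?q))"
    have "1 / sqrt (p * det S) * (1 / sqrt (p * det T)) * sqrt (p / det ?N) =
        sqrt (1 / (p * det S) * (1 / (p * det T)) * (p / det ?N))"
      by (simp add: real_sqrt_mult real_sqrt_divide)
    also have "1 / (p * det S) * (1 / (p * det T)) * (p / det ?N) = 1 / (p * det (S + T))"
      using p pos by (simp add: det_sum_matrix_inv[OF S T] field_simps)
    finally have roots: "1 / sqrt (p * det S) * (1 / sqrt (p * det T)) * sqrt (p / det ?N) =
        1 / sqrt (p * det (S + T))"
      by (simp only: real_sqrt_divide real_sqrt_one)
    have "Z * sqrt (p / det ?N) =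
        1 / sqrt (p * det S) * (1 / sqrt (p * det T)) * sqrt (p / det ?N) * ?e"
      unfolding Z_def p_def by (simp only: mult_ac)
    then show ?thesis
      unfolding roots gaussian_rbf_def unfolding p_def .
  qed
  have "(\<integral>\<^sup>+x. ennreal (gaussian_rbf x \<mu> S * gaussian_rbf x \<nu> T) \<partial>lborel) =
      (\<integral>\<^sup>+x. ennreal Z * ennreal (exp (- (1/2) * ((x - ?c) \<bullet> (?N *v (x - ?c))))) \<partial>lborel)"
    using Z by (simp only: mult ennreal_mult')
  also have "\<dots> = ennreal Z * ennreal (sqrt ((2 * pi) ^ CARD('n) / det ?N))"
    by (subst nn_integral_cmult) (simp_all only: gaussian_integral[OF N], measurable)
  also have "\<dots> = ennreal (gaussian_rbf \<nu> \<mu> (S + T))"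
    by (simp only: ennreal_mult'[OF Z, symmetric] const)
  finally show ?thesis
    using S T by (intro has_bochner_integral_nn_integral) (auto simp: gaussian_rbf_nonneg sym_pos_def_add)
qed

section \<open>The expectation of a Gaussian RBF sum\<close>

theorem lemma5:
  fixes P :: "'a measure"
    and y :: "'a \<Rightarrow> real ^ 'n"
    and p g :: "real ^ 'n \<Rightarrow> real"
    and J M :: nat
    and wbar w :: "nat \<Rightarrow> real"
    and \<mu>bar \<mu> :: "nat \<Rightarrow> real ^ 'n"
    and Sbar S :: "nat \<Rightarrow> real ^ 'n ^ 'n"
  assumes "prob_space P"
    and "J \<ge> 1"
    and "\<And>j. j \<in> {1..J} \<Longrightarrow> sym_pos_def (Sbar j)"
    and "\<And>x. p x = (\<Sum>j=1..J. wbar j * gaussian_rbf x (\<mu>bar j) (Sbar j))"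
    and "\<And>x. 0 \<le> p x"
    and "distributed P lborel y (\<lambda>x. ennreal (p x))"
    and "M \<ge> 1"
    and "\<And>i. i \<in> {1..M} \<Longrightarrow> sym_pos_def (S i)"
    and "\<And>x. g x = (\<Sum>i=1..M. w i * gaussian_rbf x (\<mu> i) (S i))"
  shows "(\<forall>i\<in>{1..M}. \<forall>j\<in>{1..J}. sym_pos_def (S i + Sbar j)) \<and>
    integrable P (\<lambda>\<omega>. g (y \<omega>)) \<and>
    prob_space.expectation P (\<lambda>\<omega>. g (y \<omega>)) =
      (\<Sum>i=1..M. \<Sum>j=1..J.
         w i * wbar j * gaussian_rbf (\<mu>bar j) (\<mu> i) (S i + Sbar j))"
proof -
  have S: "sym_pos_def (S i)" if "i \<in> {1..M}" for i using assms(8) that .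
  have Sbar: "sym_pos_def (Sbar j)" if "j \<in> {1..J}" for j using assms(3) that .
  have [measurable]: "g \<in> borel_measurable borel"
    unfolding assms(9)[abs_def] by measurable
  let ?E = "\<Sum>i=1..M. \<Sum>j=1..J. w i * wbar j * gaussian_rbf (\<mu>bar j) (\<mu> i) (S i + Sbar j)"
  have "p x * g x = (\<Sum>i=1..M. \<Sum>j=1..J. w i * wbar j *
      (gaussian_rbf x (\<mu> i) (S i) * gaussian_rbf x (\<mu>bar j) (Sbar j)))" for x
    unfolding assms(4,9) sum_product by (subst sum.swap) (simp add: mult_ac)
  moreover have "has_bochner_integral lborel (\<lambda>x. \<Sum>i=1..M. \<Sum>j=1..J. w i * wbar j *
      (gaussian_rbf x (\<mu> i) (S i) * gaussian_rbf x (\<mu>bar j) (Sbar j))) ?E"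
    by (intro has_bochner_integral_sum has_bochner_integral_mult_right
        has_bochner_integral_gaussian_rbf_mult S Sbar)
  ultimately have pg: "has_bochner_integral lborel (\<lambda>x. p x * g x) ?E"
    by simp
  have "integrable P (\<lambda>\<omega>. g (y \<omega>))"
    using distributed_integrable[OF assms(6), of g] pg assms(5) by (simp add: has_bochner_integral_iff)
  moreover have "(\<integral>\<omega>. g (y \<omega>) \<partial>P) = ?E"
    using distributed_integral[OF assms(6), of g] pg assms(5) by (simp add: has_bochner_integral_iff)
  ultimately show ?thesis
    using S Sbar by (simp add: sym_pos_def_add)
qed

end
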